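(* Let $\mathbb{X}$ be a two-dimensional real polygonal Banach space. Then the pair $(\mathbb{X},\ell_{\infty}^2)$ satisfies the weak L-P property if and only if $|Ext(B_{\mathbb{X}})|\leq 6$.
   Context: All Banach spaces are real; $\ell_\infty^2$ is $\mathbb{R}^2$ with the maximum norm. $B_{\mathbb{X}}$ is the closed unit ball of $\mathbb{X}$ and $Ext(A)$ is the set of extreme points of a convex set $A$. A two-dimensional Banach space is polygonal if its closed unit ball has only finitely many extreme points. $\mathbb{L}(\mathbb{X},\mathbb{Y})$ is the space of bounded linear operators with the operator norm; an operator $T$ is an extreme contraction if it is an extreme point of the closed unit ball of $\mathbb{L}(\mathbb{X},\mathbb{Y})$. The pair $(\mathbb{X},\mathbb{Y})$ has the weak L-P property if for each extreme contraction $T\in\mathbb{L}(\mathbb{X},\mathbb{Y})$ with $\|T\|=1$ one has $T(Ext(B_{\mathbb{X}}))\cap Ext(B_{\mathbb{Y}})\neq\emptyset$. *)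

theory Defs
  imports "HOL-Analysis.Analysis"
begin

text \<open>
  The library norm on \<^typ>\<open>real^2\<close> is Euclidean, so the space $\ell_\infty^2$ is a copy of
  \<^typ>\<open>real^2\<close> carrying the maximum norm.  The metric, topology and uniformity are those
  induced by this norm.
\<close>

typedef linf2 = "UNIV :: (real^2) set"
  morphisms vec_of_linf2 linf2_of_vec
  by simp

lemma linf2_eq_iff: "x = y \<longleftrightarrow> vec_of_linf2 x = vec_of_linf2 y"
  by (simp add: vec_of_linf2_inject)

lemma vec_of_linf2_of_vec [simp]: "vec_of_linf2 (linf2_of_vec v) = v"
  by (simp add: linf2_of_vec_inverse)

instantiation linf2 :: real_vector
begin

definition "0 = linf2_of_vec 0"
definition "x + y = linf2_of_vec (vec_of_linf2 x + vec_of_linf2 y)"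
definition "x - y = linf2_of_vec (vec_of_linf2 x - vec_of_linf2 y)"
definition "- x = linf2_of_vec (- vec_of_linf2 x)"
definition "c *\<^sub>R x = linf2_of_vec (c *\<^sub>R vec_of_linf2 x)"
lemma vec_of_linf2_simps [simp]:
  "vec_of_linf2 0 = 0"
  "vec_of_linf2 (x + y) = vec_of_linf2 x + vec_of_linf2 y"
  "vec_of_linf2 (x - y) = vec_of_linf2 x - vec_of_linf2 y"
  "vec_of_linf2 (- x) = - vec_of_linf2 x"
  "vec_of_linf2 (c *\<^sub>R x) = c *\<^sub>R vec_of_linf2 x"
  by (simp_all add: zero_linf2_def plus_linf2_def minus_linf2_def uminus_linf2_def
      scaleR_linf2_def)

instance
  by standard (auto simp: linf2_eq_iff algebra_simps)

end

instantiation linf2 :: real_normed_vector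
begin

definition "norm x = max \<bar>vec_of_linf2 x $ 1\<bar> \<bar>vec_of_linf2 x $ 2\<bar>"
definition "dist x y = norm (x - y)" for x y :: linf2
definition "sgn x = x /\<^sub>R norm x" for x :: linf2
definition [code del]:
  "(uniformity :: (linf2 \<times> linf2) filter) = (INF e\<in>{0 <..}. principal {(x, y). dist x y < e})"
definition [code del]:
  "open (U :: linf2 set) \<longleftrightarrow> (\<forall>x\<in>U. eventually (\<lambda>(x', y). x' = x \<longrightarrow> y \<in> U) uniformity)"

instance
proof
  fix x y :: linf2 and a :: real
  show "norm (x + y) \<le> norm x + norm y"
    using abs_triangle_ineq[of "vec_of_linf2 x $ 1" "vec_of_linf2 y $ 1"]
      abs_triangle_ineq[of "vec_of_linf2 x $ 2" "vec_of_linf2 y $ 2"]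
    by (simp add: norm_linf2_def max_def)
  show "norm (a *\<^sub>R x) = \<bar>a\<bar> * norm x"
    by (simp add: norm_linf2_def abs_mult max_mult_distrib_left)
  show "(norm x = 0) = (x = 0)"
    by (auto simp: norm_linf2_def linf2_eq_iff vec_eq_iff forall_2 max_def)
qed (auto simp: dist_linf2_def sgn_linf2_def
      uniformity_linf2_def open_linf2_def)

end

instance linf2 :: banach
proof
  fix X :: "nat \<Rightarrow> linf2"
  assume X: "Cauchy X"
  have comp: "\<bar>vec_of_linf2 x $ i\<bar> \<le> norm x" for x :: linf2 and i :: 2
    using exhaust_2[of i] by (auto simp: norm_linf2_def)
  have "convergent (\<lambda>n. vec_of_linf2 (X n) $ i)" for i
    unfolding Cauchy_convergent_iff[symmetric]
  proof (rule metric_CauchyI)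
    fix e :: real
    assume "e > 0"
    then obtain M where M: "\<forall>m\<ge>M. \<forall>n\<ge>M. dist (X m) (X n) < e"
      using metric_CauchyD[OF X] by blast
    have "dist (vec_of_linf2 (X m) $ i) (vec_of_linf2 (X n) $ i) < e"
      if "m \<ge> M" "n \<ge> M" for m n
      using M that comp[of "X m - X n" i] by (force simp: dist_norm)
    then show "\<exists>M. \<forall>m\<ge>M. \<forall>n\<ge>M. dist (vec_of_linf2 (X m) $ i) (vec_of_linf2 (X n) $ i) < e"
      by blast
  qed
  then obtain l where l: "(\<lambda>n. vec_of_linf2 (X n) $ i) \<longlonglongrightarrow> l i" for i
    unfolding convergent_def by metis
  define L where "L = linf2_of_vec (\<chi> i. l i)"
  have "(\<lambda>n. norm (X n - L)) \<longlonglongrightarrow> max \<bar>l 1 - l 1\<bar> \<bar>l 2 - l 2\<bar>"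
    unfolding norm_linf2_def L_def vec_of_linf2_simps vec_of_linf2_of_vec
      vector_minus_component vec_lambda_beta
    by (intro tendsto_intros l)
  then have "X \<longlonglongrightarrow> L"
    by (simp add: tendsto_norm_zero_iff LIM_zero_iff)
  then show "convergent X"
    by (auto simp: convergent_def)
qed

definition Ext :: "'a::real_vector set \<Rightarrow> 'a set"
  where "Ext A = {x. x extreme_point_of A}"

definition extreme_contraction ::
    "('a::real_normed_vector \<Rightarrow>\<^sub>L 'b::real_normed_vector) \<Rightarrow> bool"
  where "extreme_contraction T \<longleftrightarrow> T \<in> Ext (cball 0 1)"

definition weak_LP :: "'a::banach itself \<Rightarrow> 'b::banach itself \<Rightarrow> bool"
  where "weak_LP _ _ \<longleftrightarrow>
    (\<forall>T :: 'a \<Rightarrow>\<^sub>L 'b. extreme_contraction T \<and> norm T = 1 \<longrightarrow>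
      blinfun_apply T ` Ext (cball 0 1) \<inter> Ext (cball 0 1) \<noteq> {})"

text \<open>
  The notion is meant for spaces of dimension two only.
\<close>

definition polygonal :: "'a::banach itself \<Rightarrow> bool"
  where "polygonal _ \<longleftrightarrow> finite (Ext (cball (0::'a) 1))"

end

theory Submission
  imports Defs
begin

text \<open>
  An operator into \<open>\<ell>\<^sub>\<infinity>\<^sup>2\<close> is a pair of functionals, and it is an extreme contraction iff
  both are extreme in the dual ball.  These functionals are exactly those of norm one that attain
  their norm on two linearly independent vertices of the polygon, i.e. the ones defining an edge;
  up to sign such a functional attains its norm at no further vertex.  Hence the weak L-P property
  says that any two edges share a vertex up to sign.  With at most six vertices there is no room for
  two disjoint sets of four normed vertices.  With more than six, every vertex lies on an edge, and
  pairwise meeting edges through at least four vertices up to sign must all pass through a common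
  one; but of three distinct functionals that equal one at a given point, one is a proper convex
  combination of the other two, so it cannot define an edge.
\<close>

section \<open>Extreme points, the unit ball of \<open>linf2\<close> and operators into it\<close>

lemma extreme_point_of_inj_linear_image:
  assumes "linear \<phi>" "inj \<phi>" "p extreme_point_of S"
  shows "\<phi> p extreme_point_of \<phi> ` S"
  using assms by (auto simp: extreme_point_of_def open_segment_linear_image inj_image_mem_iff)

lemma self_eq_uminus_iff: "x = - x \<longleftrightarrow> x = 0" for x :: "'a::real_vector"
  by (simp add: eq_neg_iff_add_eq_0 flip: scaleR_2)

text \<open>The numbers 1 and -1 are extreme in the interval from -1 to 1, so a proper convex
  combination reaching one of them has both of its terms there.\<close>

lemma unit_between_eq:
  fixes a b t :: real
  assumes "\<bar>(1 - t) * a + t * b\<bar> = 1" "\<bar>a\<bar> \<le> 1" "\<bar>b\<bar> \<le> 1" "0 < t" "t < 1"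
  shows "a = b"
proof -
  have bounds: "(1 - t) * a \<le> 1 - t" "t * b \<le> t" "- (1 - t) \<le> (1 - t) * a" "- t \<le> t * b"
    using assms(2-5) mult_left_mono[of a 1 "1 - t"] mult_left_mono[of b 1 t]
      mult_left_mono[of "- 1" a "1 - t"] mult_left_mono[of "- 1" b t] by auto
  then consider "(1 - t) * a = 1 - t" "t * b = t" | "(1 - t) * a = - (1 - t)" "t * b = - t"
    using assms(1) by linarith
  then show ?thesis
  proof cases
    case 1
    then show ?thesis
      using assms(4,5) by simp
  next
    case 2
    then have "(1 - t) * a = (1 - t) * (- 1)" "t * b = t * (- 1)"
      by auto
    then show ?thesis
      using assms(4,5) unfolding mult_cancel_left by auto
  qed
qed

text \<open>The perturbation \<open>d\<close> exhibits \<open>x\<close> as the midpoint of two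
  distinct points of \<open>S\<close>. Failure of extremality is shown this way for vectors of
  \<open>linf2\<close> and for operators alike.\<close>

lemma not_extreme_point_of_midpoint:
  assumes "x + d \<in> S" "x - d \<in> S" "d \<noteq> 0"
  shows "\<not> x extreme_point_of S"
proof -
  have "x + d \<noteq> x - d"
    using assms(3) self_eq_uminus_iff[of d] by simp
  then have "midpoint (x + d) (x - d) \<in> open_segment (x + d) (x - d)"
    by simp
  moreover have "midpoint (x + d) (x - d) = x"
    by (simp add: midpoint_def flip: scaleR_2)
  ultimately show ?thesis
    using assms(1,2) by (auto simp: extreme_point_of_def)
qed

lemma norm_linf2_le_iff: "norm x \<le> c \<longleftrightarrow> (\<forall>i. \<bar>vec_of_linf2 x $ i\<bar> \<le> c)"
  by (simp add: norm_linf2_def forall_2)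

text \<open>A coordinate of modulus below 1 can be moved in both directions inside the ball;
  conversely, coordinates of modulus 1 are pinned one by one through
  \<open>unit_between_eq\<close>.\<close>

lemma Ext_cball_linf2: "x \<in> Ext (cball 0 1) \<longleftrightarrow> (\<forall>i. \<bar>vec_of_linf2 x $ i\<bar> = 1)"
proof
  assume x: "x \<in> Ext (cball 0 1)"
  then have "norm x \<le> 1"
    by (auto simp: Ext_def extreme_point_of_def)
  then have le: "\<bar>vec_of_linf2 x $ i\<bar> \<le> 1" for i
    using norm_linf2_le_iff by blast
  show "\<forall>i. \<bar>vec_of_linf2 x $ i\<bar> = 1"
  proof (rule ccontr)
    assume "\<not> (\<forall>i. \<bar>vec_of_linf2 x $ i\<bar> = 1)"
    then obtain i where i: "\<bar>vec_of_linf2 x $ i\<bar> \<noteq> 1"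
      by blast
    define d where "d = linf2_of_vec (axis i (1 - \<bar>vec_of_linf2 x $ i\<bar>))"
    have abs_le: "\<bar>vec_of_linf2 x $ i + (1 - \<bar>vec_of_linf2 x $ i\<bar>)\<bar> \<le> 1"
      "\<bar>vec_of_linf2 x $ i - (1 - \<bar>vec_of_linf2 x $ i\<bar>)\<bar> \<le> 1"
      using le[of i] by linarith+
    have "d \<noteq> 0"
      using i by (simp add: d_def linf2_eq_iff)
    moreover have "x + d \<in> cball 0 1" "x - d \<in> cball 0 1"
      using le abs_le by (auto simp: norm_linf2_le_iff d_def axis_def)
    ultimately show False
      using x not_extreme_point_of_midpoint[of x d] unfolding Ext_def by blast
  qed
next
  assume x: "\<forall>i. \<bar>vec_of_linf2 x $ i\<bar> = 1"
  have "x \<notin> open_segment a b" if ab: "a \<in> cball 0 1" "b \<in> cball 0 1" for a b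
  proof
    assume "x \<in> open_segment a b"
    then obtain t where t: "0 < t" "t < 1" "a \<noteq> b" "x = (1 - t) *\<^sub>R a + t *\<^sub>R b"
      by (auto simp: in_segment)
    have "vec_of_linf2 a $ i = vec_of_linf2 b $ i" for i
    proof (rule unit_between_eq)
      show "\<bar>(1 - t) * vec_of_linf2 a $ i + t * vec_of_linf2 b $ i\<bar> = 1"
        using x unfolding t(4) by simp
      show "\<bar>vec_of_linf2 a $ i\<bar> \<le> 1" "\<bar>vec_of_linf2 b $ i\<bar> \<le> 1"
        using ab by (auto simp: norm_linf2_le_iff)
    qed (use t in auto)
    then show False
      using t(3) by (simp add: linf2_eq_iff vec_eq_iff)
  qed
  then show "x \<in> Ext (cball 0 1)"
    using x by (simp add: Ext_def extreme_point_of_def norm_linf2_le_iff)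
qed

lemma blinfun_linf2_exists:
  assumes "\<And>i. linear (F i)" "\<And>i x. \<bar>F i x\<bar> \<le> c * norm x"
  obtains T :: "'a::real_normed_vector \<Rightarrow>\<^sub>L linf2" where "\<And>x i. vec_of_linf2 (T x) $ i = F i x"
proof -
  define T where "T x = linf2_of_vec (\<chi> i. F i x)" for x
  have T: "vec_of_linf2 (T x) $ i = F i x" for x i
    by (simp add: T_def)
  have "bounded_linear T"
  proof (rule bounded_linear_intro)
    show "T (x + y) = T x + T y" "T (r *\<^sub>R x) = r *\<^sub>R T x" for x y r
      using assms(1) by (simp_all add: linf2_eq_iff vec_eq_iff T linear_add linear_scale)
    show "norm (T x) \<le> norm x * c" for x
      using assms(2) by (simp add: norm_linf2_le_iff T mult.commute)
  qed
  then show thesis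
    using that[of "Blinfun T"] T by (simp add: bounded_linear_Blinfun_apply)
qed

section \<open>Coordinates and compactness in dimension two\<close>

lemma dim_2_coordinates:
  assumes "dim (UNIV :: 'a::real_vector set) = 2"
  obtains b1 b2 :: "'a::real_vector" and p1 p2 :: "'a::real_vector \<Rightarrow> real" where
    "linear p1" "linear p2" "\<And>x. x = p1 x *\<^sub>R b1 + p2 x *\<^sub>R b2"
    "p1 b1 = 1" "p2 b1 = 0" "p1 b2 = 0" "p2 b2 = 1"
proof -
  obtain B :: "'a set" where B: "independent B" "UNIV \<subseteq> span B" "card B = 2"
    using basis_exists[of "UNIV :: 'a set"] assms by metis
  then obtain b1 b2 where b: "B = {b1, b2}" "b1 \<noteq> b2"
    by (auto simp: card_2_iff)
  have sp: "x \<in> span B" for x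
    using B(2) by auto
  show thesis
  proof (rule that[of "\<lambda>x. representation B x b1" "\<lambda>x. representation B x b2" b1 b2])
    show "linear (\<lambda>x. representation B x b1)" "linear (\<lambda>x. representation B x b2)"
      by (intro linearI; simp add: representation_add representation_scale B(1) sp)+
    show "x = representation B x b1 *\<^sub>R b1 + representation B x b2 *\<^sub>R b2" for x
      using sum_representation_eq[OF B(1) sp[of x], of B] b by simp
  qed (use b B(1) in \<open>auto simp: representation_basis\<close>)
qed

text \<open>The map \<open>\<phi>\<close> identifies \<open>real \<times> real\<close> with the
  plane. The preimage \<open>K\<close> of the ball is compact and convex, so
  \<open>Krein_Milman_Minkowski\<close> applies to it, and \<open>\<phi>\<close> carries the hull
  and the extreme points back.\<close>

lemma cball_eq_hull_Ext:
  assumes "dim (UNIV :: 'a::banach set) = 2"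
  shows "cball (0::'a) 1 = convex hull Ext (cball 0 1)"
proof -
  obtain b1 b2 :: 'a and p1 p2 where p: "linear p1" "linear p2" "\<And>x. x = p1 x *\<^sub>R b1 + p2 x *\<^sub>R b2"
    "p1 b1 = 1" "p2 b1 = 0" "p1 b2 = 0" "p2 b2 = 1"
    by (rule dim_2_coordinates[OF assms]) (rule that)
  define \<phi> :: "real \<times> real \<Rightarrow> 'a" where "\<phi> = (\<lambda>(s, t). s *\<^sub>R b1 + t *\<^sub>R b2)"
  have lin: "linear \<phi>"
    by (rule linearI) (auto simp: \<phi>_def algebra_simps)
  have inv: "(p1 (\<phi> q), p2 (\<phi> q)) = q" for q
    using p by (auto simp: \<phi>_def linear_add linear_scale split: prod.split)
  have inj: "inj \<phi>"
    by (metis inv injI)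
  have "x \<in> range \<phi>" for x
    using p(3)[of x] by (intro image_eqI[of _ _ "(p1 x, p2 x)"]) (auto simp: \<phi>_def)
  then have surj: "range \<phi> = UNIV"
    by auto
  have cont: "continuous_on A (\<lambda>q. norm (\<phi> q))" for A
    unfolding \<phi>_def case_prod_unfold by (intro continuous_intros)
  define K where "K = {q. norm (\<phi> q) \<le> 1}"
  have image_K: "\<phi> ` K = cball 0 1"
    using surj by (auto simp: K_def) (metis UNIV_I image_iff mem_Collect_eq)
  have "closed K"
    unfolding K_def using cont by (intro closed_Collect_le) auto
  moreover have "bounded K"
  proof -
    \<comment> \<open>The least value of the transported norm on the Euclidean unit circle is
      positive by injectivity; by homogeneity its reciprocal bounds \<open>K\<close>.\<close>
    obtain m where m: "m \<in> sphere 0 1" "\<And>q. q \<in> sphere 0 1 \<Longrightarrow> norm (\<phi> m) \<le> norm (\<phi> q)"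
      using continuous_attains_inf[OF _ _ cont, of "sphere (0::real \<times> real) 1"] compact_sphere
      by (metis norm_Pair1 norm_one mem_sphere_0 empty_iff)
    have "\<phi> m \<noteq> 0"
      using m(1) inj linear_0[OF lin] by (metis injD mem_sphere_0 norm_zero zero_neq_one)
    then have pos: "norm (\<phi> m) > 0"
      by simp
    have "norm q \<le> 1 / norm (\<phi> m)" if "q \<in> K" for q
    proof (cases "q = 0")
      case False
      have "norm (\<phi> m) \<le> norm (\<phi> ((1 / norm q) *\<^sub>R q))"
        using False by (intro m(2)) auto
      also have "\<dots> = norm (\<phi> q) / norm q"
        using lin by (simp add: linear_scale)
      also have "\<dots> \<le> 1 / norm q"
        using that by (intro divide_right_mono) (auto simp: K_def)
      finally show ?thesis
        using pos False by (simp add: field_simps)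
    qed (use pos in auto)
    then show ?thesis
      unfolding bounded_iff by blast
  qed
  ultimately have "compact K"
    by (simp add: compact_eq_bounded_closed)
  moreover have "convex K"
  proof -
    have "K = \<phi> -` cball 0 1"
      by (auto simp: K_def)
    then show ?thesis
      using convex_linear_vimage[OF lin convex_cball] by metis
  qed
  ultimately have K: "K = convex hull {q. q extreme_point_of K}"
    by (rule Krein_Milman_Minkowski)
  have "cball 0 1 = convex hull (\<phi> ` {q. q extreme_point_of K})"
    using K image_K convex_hull_linear_image[OF lin] by metis
  also have "\<dots> \<subseteq> convex hull Ext (cball 0 1)"
    using extreme_point_of_inj_linear_image[OF lin inj, of _ K] image_K
    by (intro hull_mono) (auto simp: Ext_def)
  finally have "cball (0::'a) 1 \<subseteq> convex hull Ext (cball 0 1)" .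
  moreover have "convex hull Ext (cball (0::'a) 1) \<subseteq> cball 0 1"
    by (intro hull_minimal convex_cball) (auto simp: Ext_def extreme_point_of_def)
  ultimately show ?thesis
    by blast
qed

section \<open>Plane geometry of the unit polygon\<close>

text \<open>\<open>D\<close> is the determinant with respect to a fixed basis; it makes the plane coordinate-free.\<close>

locale polygonal_plane =
  fixes D :: "'a::banach \<Rightarrow> 'a \<Rightarrow> real"
  assumes linear_D: "linear (D u)"
    and D_swap: "D u v = - D v u"
    and Cramer: "D u v *\<^sub>R x = D x v *\<^sub>R u + D u x *\<^sub>R v"
    and nondegenerate: "\<exists>u v. D u v \<noteq> 0"
    and finite_Ext: "finite (Ext (cball (0::'a) 1))"
    and hull_Ext: "cball (0::'a) 1 = convex hull Ext (cball 0 1)"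
begin

abbreviation E :: "'a set" where "E \<equiv> Ext (cball 0 1)"

lemma D_self [simp]: "D u u = 0"
  using D_swap[of u u] by simp

lemma linear_Cramer:
  assumes "linear f"
  shows "D u v * f x = D x v * f u + D u x * f v"
  using arg_cong[OF Cramer[of u v x], of f] assms by (simp add: linear_add linear_scale)

lemma linear_eqI:
  assumes "linear f" "linear g" "D u v \<noteq> 0" "f u = g u" "f v = g v"
  shows "f x = (g x :: real)"
  using linear_Cramer[OF assms(1), of u v x] linear_Cramer[OF assms(2), of u v x] assms(3-5)
  by (metis mult_left_cancel)

lemma ex_D_neq_0:
  assumes "u \<noteq> 0"
  obtains v where "D u v \<noteq> 0"
proof -
  obtain a b where ab: "D a b \<noteq> 0"
    using nondegenerate by blast
  show thesis
  proof (rule ccontr)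
    assume "\<not> thesis"
    then have "D u v = 0" for v
      using that by blast
    then have "D a b *\<^sub>R u = 0"
      using Cramer[of a b u] D_swap[of a u] by simp
    then show False
      using ab assms by simp
  qed
qed

lemma D_eq_0_imp_parallel:
  assumes "u \<noteq> 0" "D u x = 0"
  obtains c where "x = c *\<^sub>R u"
proof -
  obtain v where v: "D u v \<noteq> 0"
    using ex_D_neq_0[OF assms(1)] .
  have "D u v *\<^sub>R x = D x v *\<^sub>R u"
    using Cramer[of u v x] assms(2) by simp
  then have "x = (D x v / D u v) *\<^sub>R u"
    using v by (metis divide_inverse_commute scaleR_scaleR scaleR_one left_inverse)
  then show thesis
    using that by blast
qed

text \<open>The centre is the midpoint of two opposite unit vectors, and a nonzero vector of norm
  below 1 lies strictly between 0 and its normalization.\<close>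

lemma norm_Ext:
  assumes "v \<in> E"
  shows "norm v = 1"
proof (rule ccontr)
  assume ne: "norm v \<noteq> 1"
  have v: "norm v \<le> 1" "\<And>a b. norm a \<le> 1 \<Longrightarrow> norm b \<le> 1 \<Longrightarrow> v \<notin> open_segment a b"
    using assms by (auto simp: Ext_def extreme_point_of_def)
  show False
  proof (cases "v = 0")
    case True
    obtain u x where "D u x \<noteq> 0"
      using nondegenerate by blast
    then have "x \<noteq> 0"
      using linear_0[OF linear_D] by auto
    then have "midpoint (sgn x) (- sgn x) \<in> open_segment (sgn x) (- sgn x)"
      by (simp add: sgn_zero_iff self_eq_uminus_iff)
    then have "v \<in> open_segment (sgn x) (- sgn x)"
      using True by (simp add: midpoint_def)
    then show False
      using v(2)[of "sgn x" "- sgn x"] by (simp add: norm_sgn)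
  next
    case False
    then have "v \<in> open_segment 0 (sgn v)"
      using v(1) ne by (auto simp: in_segment sgn_div_norm intro!: exI[of _ "norm v"])
    then show False
      using v(2)[of 0 "sgn v"] by (simp add: norm_sgn)
  qed
qed

lemma Ext_nonzero: "v \<in> E \<Longrightarrow> v \<noteq> 0"
  using norm_Ext by fastforce

lemma uminus_Ext:
  assumes "v \<in> E"
  shows "- v \<in> E"
proof -
  have "linear (uminus :: 'a \<Rightarrow> 'a)" "inj (uminus :: 'a \<Rightarrow> 'a)"
    by (auto intro: linearI injI)
  moreover have "uminus ` cball (0::'a) 1 = cball 0 1"
    by (auto simp: image_iff) (rule_tac x = "- x" in bexI, auto)
  ultimately show ?thesis
    using extreme_point_of_inj_linear_image[of uminus v "cball 0 1"] assms by (simp add: Ext_def)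
qed

text \<open>The strip where \<open>f\<close> has modulus at most 1 is convex, so once it contains
  the vertices it contains the whole ball. A norm bound thus reduces to finitely many
  vertices.\<close>

lemma functional_bound:
  assumes "linear f" "\<And>v. v \<in> E \<Longrightarrow> \<bar>f v\<bar> \<le> 1"
  shows "\<bar>f x\<bar> \<le> norm x"
proof -
  have "convex (f -` {-1..1})"
    using assms(1) by (intro convex_linear_vimage) auto
  then have "convex hull E \<subseteq> f -` {-1..1}"
    using assms(2) by (intro hull_minimal) (auto simp: abs_le_iff minus_le_iff)
  then have "\<bar>f (sgn x)\<bar> \<le> 1"
    unfolding hull_Ext[symmetric] by (auto simp: abs_le_iff norm_sgn subset_iff)
  then show ?thesis
    using assms(1) linear_0[OF assms(1)]
    by (cases "x = 0") (auto simp: sgn_div_norm linear_scale abs_mult field_simps)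
qed

text \<open>Every multiple of \<open>f\<close> satisfies the hypotheses of
  \<open>functional_bound\<close>, so none may exceed the norm at \<open>x\<close>; \<open>k\<close>
  makes the value \<open>norm x + 1\<close>. In effect the vertices span the plane.\<close>

lemma functional_eq_0:
  assumes "linear f" "\<And>v. v \<in> E \<Longrightarrow> f v = 0"
  shows "f x = (0::real)"
proof (rule ccontr)
  assume ne: "f x \<noteq> 0"
  define k where "k = (norm x + 1) / f x"
  have "\<bar>k * f x\<bar> \<le> norm x"
    using assms by (intro functional_bound linearI) (auto simp: linear_add linear_scale algebra_simps)
  then show False
    using ne by (simp add: k_def)
qed

lemma parallel_Ext:
  assumes "u \<in> E" "v \<in> E" "D u v = 0"
  shows "v = u \<or> v = - u"
proof -
  obtain c where c: "v = c *\<^sub>R u"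
    using D_eq_0_imp_parallel[OF Ext_nonzero[OF assms(1)] assms(3)] .
  then have "\<bar>c\<bar> = 1"
    using norm_Ext[OF assms(1)] norm_Ext[OF assms(2)] by simp
  then show ?thesis
    using c by (auto simp: abs_if split: if_splits)
qed

lemma not_between_Ext:
  assumes "u \<in> E" "v \<in> E" "w \<in> E" "u \<noteq> w" "0 < t" "t < 1"
  shows "v \<noteq> (1 - t) *\<^sub>R u + t *\<^sub>R w"
proof -
  have "u \<in> cball 0 1" "w \<in> cball 0 1" "v \<notin> open_segment u w"
    using assms(1-3) unfolding Ext_def extreme_point_of_def by blast+
  then show ?thesis
    using assms(4-6) unfolding in_segment by blast
qed

text \<open>Of three distinct points on a line one lies strictly between the other two and is not
  extreme. The position of \<open>t\<close> in the affine expression of \<open>v\<close> through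
  \<open>u\<close> and \<open>w\<close> decides which one is in the middle.\<close>

lemma Ext_collinear:
  assumes E: "u \<in> E" "v \<in> E" "w \<in> E" and "linear f"
    and f: "f u = (1::real)" "f v = 1" "f w = 1" and "u \<noteq> w"
  shows "v = u \<or> v = w"
proof (rule ccontr)
  assume ne: "\<not> (v = u \<or> v = w)"
  \<comment> \<open>Parallel vertices are equal or opposite, and \<open>w = - u\<close> would give
    \<open>f w = - 1\<close>.\<close>
  have D: "D u w \<noteq> 0"
    using parallel_Ext[of u w] assms linear_neg[of f u] by auto
  define t where "t = D u v / D u w"
  have "D u w = D v w + D u v"
    using linear_Cramer[OF \<open>linear f\<close>, of u w v] f by simp
  then have t': "1 - t = D v w / D u w"
    using D by (simp add: t_def field_simps)
  have v: "v = (1 - t) *\<^sub>R u + t *\<^sub>R w"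
    unfolding t' unfolding t_def using arg_cong[OF Cramer[of u w v], of "scaleR (1 / D u w)"] D
    by (simp add: scaleR_add_right)
  consider "t < 0" | "t = 0" | "0 < t" "t < 1" | "t = 1" | "t > 1"
    by linarith
  then show False
  proof cases
    case 1
    \<comment> \<open>For negative \<open>t\<close> the middle point is \<open>u\<close>, and
      \<open>s\<close> comes from solving the relation for \<open>u\<close>; for \<open>t\<close>
      above 1 the middle point is \<open>w\<close> instead.\<close>
    define s where "s = - t / (1 - t)"
    have s: "(1 - s) * (1 - t) = 1" "(1 - s) * t + s = 0" "0 < s" "s < 1"
      using 1 by (auto simp: s_def field_simps)
    have "(1 - s) *\<^sub>R v + s *\<^sub>R w = ((1 - s) * (1 - t)) *\<^sub>R u + ((1 - s) * t + s) *\<^sub>R w"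
      unfolding v by (simp add: scaleR_add_right scaleR_add_left)
    then have "u = (1 - s) *\<^sub>R v + s *\<^sub>R w"
      unfolding s(1,2) by simp
    then show False
      using not_between_Ext[OF E(2,1,3) _ s(3,4)] ne by blast
  next
    case 5
    define s where "s = 1 / t"
    have s: "(1 - s) + s * (1 - t) = 0" "s * t = 1" "0 < s" "s < 1"
      using 5 by (auto simp: s_def field_simps)
    have "(1 - s) *\<^sub>R u + s *\<^sub>R v = ((1 - s) + s * (1 - t)) *\<^sub>R u + (s * t) *\<^sub>R w"
      unfolding v by (simp add: scaleR_add_right scaleR_add_left)
    then have "w = (1 - s) *\<^sub>R u + s *\<^sub>R v"
      unfolding s(1,2) by simp
    then show False
      using not_between_Ext[OF E(1,3,2) _ s(3,4)] ne by blast
  next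
    case 3
    then show False
      using v not_between_Ext[OF E \<open>u \<noteq> w\<close>] by blast
  next
    case 2
    then have "v = u"
      unfolding v by simp
    then show False
      using ne by simp
  next
    case 4
    then have "v = w"
      unfolding v by simp
    then show False
      using ne by simp
  qed
qed

section \<open>Edge functionals and the vertices where they attain their norm\<close>

text \<open>These are the vertices of the dual polygon: the line \<open>f = 1\<close> supports the
  ball along an edge. When \<open>f u\<close> and \<open>f w\<close> have opposite signs, the edge
  joins vertices of the form \<open>u\<close> and \<open>- w\<close> up to a common sign.\<close>

definition edge_functional :: "('a \<Rightarrow> real) \<Rightarrow> bool"
  where "edge_functional f \<longleftrightarrow> linear f \<and> (\<forall>v\<in>E. \<bar>f v\<bar> \<le> 1) \<and>
    (\<exists>u\<in>E. \<exists>w\<in>E. D u w \<noteq> 0 \<and> \<bar>f u\<bar> = 1 \<and> \<bar>f w\<bar> = 1)"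

definition normed_vertices :: "('a \<Rightarrow> real) \<Rightarrow> 'a set"
  where "normed_vertices f = {v \<in> E. \<bar>f v\<bar> = 1}"

lemma scale_by_sign_Ext: "v \<in> E \<Longrightarrow> \<bar>c\<bar> = 1 \<Longrightarrow> c *\<^sub>R v \<in> E"
  using uminus_Ext[of v] by (auto simp: abs_if split: if_splits)

text \<open>Multiplication of each normed vertex by its own value, 1 or -1, puts all of them on the
  line \<open>f = 1\<close>, where \<open>Ext_collinear\<close> leaves room for two. One of them may
  be prescribed up to sign, which lets edges be compared through a shared vertex.\<close>

lemma normed_vertices_edge:
  assumes "edge_functional f" "a \<in> normed_vertices f"
  obtains b where "b \<in> E" "D a b \<noteq> 0" "normed_vertices f = {a, - a, b, - b}"
proof -
  obtain u w where uw: "u \<in> E" "w \<in> E" "D u w \<noteq> 0" "\<bar>f u\<bar> = 1" "\<bar>f w\<bar> = 1"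
    and lin: "linear f"
    using assms(1) unfolding edge_functional_def by blast
  have a: "a \<in> E" "\<bar>f a\<bar> = 1"
    using assms(2) by (auto simp: normed_vertices_def)
  \<comment> \<open>By Cramer's rule a vector parallel to both \<open>u\<close> and \<open>w\<close>
    would vanish.\<close>
  have "D a u \<noteq> 0 \<or> D a w \<noteq> 0"
  proof (rule ccontr)
    assume "\<not> (D a u \<noteq> 0 \<or> D a w \<noteq> 0)"
    then have "D u w *\<^sub>R a = 0"
      using Cramer[of u w a] D_swap[of u a] by simp
    then show False
      using uw(3) Ext_nonzero[OF a(1)] by simp
  qed
  then obtain b where b: "b \<in> E" "D a b \<noteq> 0" "\<bar>f b\<bar> = 1"
    using uw by blast
  have "v \<in> {a, - a, b, - b}" if v: "v \<in> E" "\<bar>f v\<bar> = 1" for v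
  proof -
    have sgn: "f (f x *\<^sub>R x) = 1" if "\<bar>f x\<bar> = 1" for x
      using that lin by (auto simp: linear_scale abs_if split: if_splits)
    have ne: "f a *\<^sub>R a \<noteq> f b *\<^sub>R b"
    proof
      assume eq: "f a *\<^sub>R a = f b *\<^sub>R b"
      have "f b * D a b = D a (f b *\<^sub>R b)"
        using linear_scale[OF linear_D] by simp
      also have "\<dots> = 0"
        using linear_scale[OF linear_D, of a "f a" a] unfolding eq[symmetric] by simp
      finally show False
        using b by auto
    qed
    have "f v *\<^sub>R v = f a *\<^sub>R a \<or> f v *\<^sub>R v = f b *\<^sub>R b"
      by (rule Ext_collinear[OF scale_by_sign_Ext[OF a] scale_by_sign_Ext[OF v]
            scale_by_sign_Ext[OF b(1,3)] lin sgn[OF a(2)] sgn[OF v(2)] sgn[OF b(3)] ne])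
    moreover have "f x *\<^sub>R x = x \<or> f x *\<^sub>R x = - x" if "\<bar>f x\<bar> = 1" for x
      using that by (auto simp: abs_if split: if_splits)
    then have "f a *\<^sub>R a \<in> {a, - a}" "f b *\<^sub>R b \<in> {b, - b}" "v \<in> {f v *\<^sub>R v, - (f v *\<^sub>R v)}"
      using a(2) b(3) v(2) by fastforce+
    ultimately show ?thesis
      by fastforce
  qed
  then have "normed_vertices f \<subseteq> {a, - a, b, - b}"
    unfolding normed_vertices_def by blast
  moreover have "{a, - a, b, - b} \<subseteq> normed_vertices f"
    using a b uminus_Ext[OF a(1)] uminus_Ext[OF b(1)] linear_neg[OF lin]
    by (simp add: normed_vertices_def)
  ultimately have "normed_vertices f = {a, - a, b, - b}"
    by (rule equalityI)
  then show thesis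
    using that b by blast
qed

lemma card_normed_vertices:
  assumes "edge_functional f"
  shows "card (normed_vertices f) = 4"
proof -
  obtain a where a: "a \<in> normed_vertices f"
    using assms unfolding edge_functional_def normed_vertices_def by blast
  obtain b where b: "b \<in> E" "D a b \<noteq> 0" "normed_vertices f = {a, - a, b, - b}"
    using normed_vertices_edge[OF assms a] .
  have "a \<in> E"
    using a by (simp add: normed_vertices_def)
  then have "a \<noteq> - a" "b \<noteq> - b"
    using b(1) Ext_nonzero by (auto simp: self_eq_uminus_iff)
  moreover have "a \<noteq> b" "a \<noteq> - b"
    using b(2) linear_neg[OF linear_D, of b b] D_swap[of "- b" b] by auto
  moreover from this have "- a \<noteq> b"
    by auto
  ultimately show ?thesis
    unfolding b(3) by simp
qed

text \<open>A functional equal to 1 at \<open>v\<close> is tilted by a multiple of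
  \<open>D v\<close>, which keeps the value at \<open>v\<close>, until it touches a vertex on the
  positive side of the line through 0 and \<open>v\<close>. Convexity then controls the negative
  side, and the symmetry of \<open>E\<close> gives the lower bound.\<close>

lemma exists_edge_functional:
  assumes v: "v \<in> E"
  obtains f where "edge_functional f" "f v = 1"
proof -
  have lin: "linear (D v)"
    by (rule linear_D)
  obtain e where e: "D v e \<noteq> 0"
    using ex_D_neq_0[OF Ext_nonzero[OF v]] .
  define f0 where "f0 x = D x e / D v e" for x
  \<comment> \<open>The locale gives linearity of \<open>D\<close> in the second argument, hence the
    swap.\<close>
  have f0: "f0 = (\<lambda>x. (- 1 / D v e) * D e x)"
    by (simp add: f0_def D_swap[of _ e] fun_eq_iff)
  have lin0: "linear f0"
    using linear_D[of e] unfolding f0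
    by (intro linearI) (auto simp: linear_add linear_scale algebra_simps)
  have f0v: "f0 v = 1"
    using e by (simp add: f0_def)
  define P where "P = {w \<in> E. D v w > 0}"
  have "finite P"
    using finite_Ext by (simp add: P_def)
  have "P \<noteq> {}"
  proof -
    obtain w where "w \<in> E" "D v w \<noteq> 0"
      using functional_eq_0[OF lin, of e] e by blast
    then show ?thesis
      using uminus_Ext[of w] linear_neg[OF lin, of w] by (cases "D v w > 0") (auto simp: P_def)
  qed
  \<comment> \<open>This is the largest \<open>t\<close> for which \<open>f0 + t * D v\<close> stays
    at most 1 on \<open>P\<close>; equality holds at a minimizing vertex \<open>a\<close>.\<close>
  define t where "t = Min ((\<lambda>w. (1 - f0 w) / D v w) ` P)"
  have t_le: "t \<le> (1 - f0 w) / D v w" if "w \<in> P" for w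
    unfolding t_def using that \<open>finite P\<close> by (intro Min_le) auto
  obtain a where a: "a \<in> P" "t = (1 - f0 a) / D v a"
    using Min_in[of "(\<lambda>w. (1 - f0 w) / D v w) ` P"] \<open>finite P\<close> \<open>P \<noteq> {}\<close> unfolding t_def by blast
  then have a': "a \<in> E" "D v a > 0"
    by (auto simp: P_def)
  define f where "f x = f0 x + t * D v x" for x
  have linf: "linear f"
    unfolding f_def using lin lin0 by (intro linearI) (auto simp: linear_add linear_scale algebra_simps)
  have fv: "f v = 1"
    by (simp add: f_def f0v)
  have fa: "f a = 1"
    using a' by (simp add: f_def a(2))
  have le: "f w \<le> 1" if w: "w \<in> E" for w
  proof -
    consider "D v w > 0" | "D v w = 0" | "D v w < 0"
      by linarith
    then show ?thesis
    proof cases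
      case 1
      then show ?thesis
        using t_le[of w] w by (simp add: P_def f_def field_simps)
    next
      case 2
      then show ?thesis
        using parallel_Ext[OF v w] fv linear_neg[OF linf, of v] by auto
    next
      case 3
      \<comment> \<open>If \<open>f w > 1\<close>, the segment from \<open>a\<close> to \<open>w\<close> would leave the unit ball where it crosses the ray through \<open>v\<close>.\<close>
      define p q where "p = D v a" and "q = - D v w"
      have pq: "p > 0" "q > 0"
        using 3 a' by (auto simp: p_def q_def)
      have "D v (q *\<^sub>R a + p *\<^sub>R w) = 0"
        unfolding linear_add[OF lin] linear_scale[OF lin] by (simp add: p_def q_def)
      then obtain c where c: "q *\<^sub>R a + p *\<^sub>R w = c *\<^sub>R v"
        using D_eq_0_imp_parallel[OF Ext_nonzero[OF v]] by blast
      have "q + p * f w = f (q *\<^sub>R a + p *\<^sub>R w)"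
        using linf fa by (simp add: linear_add linear_scale)
      also have "\<dots> = c"
        unfolding c using linf fv by (simp add: linear_scale)
      also have "\<dots> \<le> norm (c *\<^sub>R v)"
        using norm_Ext[OF v] by simp
      also have "\<dots> \<le> norm (q *\<^sub>R a) + norm (p *\<^sub>R w)"
        unfolding c[symmetric] by (rule norm_triangle_ineq)
      also have "\<dots> = q + p"
        using norm_Ext[OF a'(1)] norm_Ext[OF w] pq by simp
      finally show ?thesis
        using pq by simp
    qed
  qed
  have "\<bar>f w\<bar> \<le> 1" if "w \<in> E" for w
    using le[OF that] le[OF uminus_Ext[OF that]] linear_neg[OF linf, of w] by linarith
  moreover have "D v a \<noteq> 0" "\<bar>f v\<bar> = 1" "\<bar>f a\<bar> = 1"
    using a' fv fa by auto
  ultimately have "edge_functional f"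
    unfolding edge_functional_def using linf v a'(1) by blast
  then show thesis
    using that fv by blast
qed

section \<open>Extremality in the dual ball and edges through a common vertex\<close>

lemma edge_functional_linear: "edge_functional f \<Longrightarrow> linear f"
  by (simp add: edge_functional_def)

lemma edge_functional_le_1: "edge_functional f \<Longrightarrow> v \<in> E \<Longrightarrow> \<bar>f v\<bar> \<le> 1"
  unfolding edge_functional_def by blast

lemma edge_functional_bound:
  assumes "edge_functional f"
  shows "\<bar>f x\<bar> \<le> norm x"
  by (rule functional_bound[OF edge_functional_linear[OF assms] edge_functional_le_1[OF assms]])

text \<open>At two independent vertices where \<open>g\<close> has modulus 1,
  \<open>unit_between_eq\<close> forces \<open>f\<close> and \<open>h\<close> to agree, hence they
  agree everywhere. So edge functionals are extreme in the dual ball.\<close>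

lemma edge_functional_not_between:
  assumes g: "edge_functional g"
    and f: "linear f" "\<And>v. v \<in> E \<Longrightarrow> \<bar>f v\<bar> \<le> 1" and h: "linear h" "\<And>v. v \<in> E \<Longrightarrow> \<bar>h v\<bar> \<le> 1"
    and t: "0 < t" "t < 1" and between: "\<And>x. g x = (1 - t) * f x + t * h x"
  shows "f x = h x"
proof -
  obtain u w where uw: "u \<in> E" "w \<in> E" "D u w \<noteq> 0" "\<bar>g u\<bar> = 1" "\<bar>g w\<bar> = 1"
    using g unfolding edge_functional_def by blast
  have "f v = h v" if "v \<in> E" "\<bar>g v\<bar> = 1" for v
    by (rule unit_between_eq[OF _ f(2)[OF that(1)] h(2)[OF that(1)] t]) (rule that(2)[unfolded between])
  from linear_eqI[OF f(1) h(1) uw(3) this[OF uw(1,4)] this[OF uw(2,5)]] show ?thesis .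
qed

text \<open>A functional with value 1 at \<open>a\<close> is determined by its value at
  \<open>e\<close>, so the middle one of the three is a proper convex combination of the outer two,
  against \<open>edge_functional_not_between\<close>.\<close>

lemma edge_functionals_at_vertex_aux:
  assumes "edge_functional f" "edge_functional g" "edge_functional h"
    and "f a = 1" "g a = 1" "h a = 1" and e: "D a e \<noteq> 0" and less: "f e < g e" "g e < h e"
  shows False
proof -
  have lin: "linear f" "linear g" "linear h"
    using assms(1-3) by (blast intro: edge_functional_linear)+
  define t where "t = (g e - f e) / (h e - f e)"
  have t: "0 < t" "t < 1"
    using less by (auto simp: t_def field_simps)
  have "t * (h e - f e) = g e - f e"
    using less by (simp add: t_def)
  then have ge: "g e = (1 - t) * f e + t * h e"
    by (simp add: algebra_simps)
  have "linear (\<lambda>x. (1 - t) * f x + t * h x)"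
    by (intro linearI) (simp_all add: linear_add lin linear_scale algebra_simps)
  then have between: "g x = (1 - t) * f x + t * h x" for x
    by (rule linear_eqI[OF lin(2) _ e]) (simp_all add: ge assms(4-6))
  have "f e = h e"
    by (rule edge_functional_not_between[OF assms(2) lin(1) edge_functional_le_1[OF assms(1)]
          lin(3) edge_functional_le_1[OF assms(3)] t between])
  then show False
    using less by simp
qed

lemma edge_functional_normalize:
  assumes "edge_functional f" "a \<in> normed_vertices f"
  shows "edge_functional (\<lambda>x. f a * f x)" "normed_vertices (\<lambda>x. f a * f x) = normed_vertices f"
    "f a * f a = 1"
proof -
  have fa: "\<bar>f a\<bar> = 1"
    using assms(2) by (simp add: normed_vertices_def)
  then have abs: "\<bar>f a * f x\<bar> = \<bar>f x\<bar>" for x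
    by (simp add: abs_mult)
  have "linear (\<lambda>x. f a * f x)"
    using edge_functional_linear[OF assms(1)] by (intro linearI) (auto simp: linear_add linear_scale algebra_simps)
  then show "edge_functional (\<lambda>x. f a * f x)"
    using assms(1) unfolding edge_functional_def abs by blast
  show "normed_vertices (\<lambda>x. f a * f x) = normed_vertices f"
    by (simp add: normed_vertices_def abs)
  show "f a * f a = 1"
    using fa by (metis abs_mult_self_eq mult_1)
qed

text \<open>Up to sign, at most two edges pass through a vertex. After normalization to the value 1
  at \<open>a\<close>, functionals with equal values at \<open>e\<close> coincide, and three
  distinct values are excluded in each of the six orders.\<close>

lemma edge_functionals_at_vertex:
  assumes "edge_functional f" "edge_functional g" "edge_functional h"
    and a: "a \<in> normed_vertices f" "a \<in> normed_vertices g" "a \<in> normed_vertices h"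
  shows "normed_vertices f = normed_vertices g \<or> normed_vertices f = normed_vertices h \<or>
    normed_vertices g = normed_vertices h"
proof -
  define f' g' h' where "f' x = f a * f x" and "g' x = g a * g x" and "h' x = h a * h x" for x
  note norm = edge_functional_normalize[OF assms(1) a(1)] edge_functional_normalize[OF assms(2) a(2)]
    edge_functional_normalize[OF assms(3) a(3)]
  have edge: "edge_functional f'" "edge_functional g'" "edge_functional h'"
    using norm unfolding f'_def g'_def h'_def by blast+
  have N: "normed_vertices f' = normed_vertices f" "normed_vertices g' = normed_vertices g"
      "normed_vertices h' = normed_vertices h"
    using norm unfolding f'_def g'_def h'_def by blast+
  have one: "f' a = 1" "g' a = 1" "h' a = 1"
    using norm unfolding f'_def g'_def h'_def by blast+
  have "a \<in> E"
    using a(1) by (simp add: normed_vertices_def)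
  then obtain e where e: "D a e \<noteq> 0"
    using ex_D_neq_0[OF Ext_nonzero] by blast
  have eq: "normed_vertices p = normed_vertices q"
    if "edge_functional p" "edge_functional q" "p a = 1" "q a = 1" "p e = q e" for p q
  proof -
    have "p x = q x" for x
      using linear_eqI[OF _ _ e] edge_functional_linear that by metis
    then have "p = q"
      by (rule ext)
    then show ?thesis
      by simp
  qed
  note less = edge_functionals_at_vertex_aux[OF _ _ _ _ _ _ e]
  show ?thesis
    unfolding N[symmetric]
    using eq[OF edge(1,2) one(1,2)] eq[OF edge(1,3) one(1,3)] eq[OF edge(2,3) one(2,3)]
      less[OF edge(1,2,3) one(1,2,3)] less[OF edge(1,3,2) one(1,3,2)]
      less[OF edge(2,1,3) one(2,1,3)] less[OF edge(2,3,1) one(2,3,1)]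
      less[OF edge(3,1,2) one(3,1,2)] less[OF edge(3,2,1) one(3,2,1)]
    by (metis linorder_neqE_linordered_idom)
qed

section \<open>Pairwise meeting edges and the number of vertices\<close>

text \<open>Two different edges \<open>f\<close> and \<open>g\<close> share some \<open>x\<close>;
  with their other endpoints \<open>y\<close> and \<open>z\<close> they account for six vertices up
  to sign choices. An edge \<open>h\<close> through a further vertex \<open>e\<close> cannot pass
  through \<open>x\<close>, so it meets \<open>f\<close> in \<open>y\<close> and \<open>g\<close> in
  \<open>z\<close>, which leaves no place for \<open>e\<close>.\<close>

lemma edges_meet_imp_card_le_6:
  assumes meet: "\<And>f g. edge_functional f \<Longrightarrow> edge_functional g \<Longrightarrow>
    normed_vertices f \<inter> normed_vertices g \<noteq> {}"
  shows "card E \<le> 6"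
proof (rule ccontr)
  assume "\<not> card E \<le> 6"
  then have many: "\<not> E \<subseteq> A" if "card A \<le> 6" "finite A" for A
    using card_mono[OF that(2), of E] that(1) by linarith
  have edge_at: "\<exists>f. edge_functional f \<and> c \<in> normed_vertices f" if c: "c \<in> E" for c
  proof -
    obtain f where "edge_functional f" "f c = 1"
      using exists_edge_functional[OF c] .
    then show ?thesis
      by (intro exI[of _ f]) (simp add: normed_vertices_def c)
  qed
  have neg: "- v \<in> normed_vertices f \<longleftrightarrow> v \<in> normed_vertices f" if "edge_functional f" for f v
  proof -
    have "- v \<in> E \<longleftrightarrow> v \<in> E"
      using uminus_Ext[of v] uminus_Ext[of "- v"] unfolding minus_minus by blast
    then show ?thesis
      by (simp add: normed_vertices_def linear_neg[OF edge_functional_linear[OF that]])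
  qed
  obtain a where "a \<in> E"
    using many[of "{}"] by (simp only: card.empty finite.emptyI) blast
  then obtain f where f: "edge_functional f"
    using edge_at by blast
  have "card (normed_vertices f) = 4" "finite (normed_vertices f)"
    using card_normed_vertices[OF f] by (auto intro: card_ge_0_finite)
  then obtain c where c: "c \<in> E" "c \<notin> normed_vertices f"
    using many[of "normed_vertices f"] by (simp only:) fastforce
  then obtain g where g: "edge_functional g" "c \<in> normed_vertices g"
    using edge_at by blast
  obtain x where x: "x \<in> normed_vertices f" "x \<in> normed_vertices g"
    using meet[OF f g(1)] by blast
  obtain y where y: "normed_vertices f = {x, - x, y, - y}"
    using normed_vertices_edge[OF f x(1)] by blast
  obtain z where z: "normed_vertices g = {x, - x, z, - z}"
    using normed_vertices_edge[OF g(1) x(2)] by blast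
  have "card {x, - x, y, - y, z, - z} \<le> 6"
    using card_length[of "[x, - x, y, - y, z, - z]"] by simp
  then obtain e where e: "e \<in> E" "e \<notin> {x, - x, y, - y, z, - z}"
    using many[of "{x, - x, y, - y, z, - z}"] by blast
  obtain h where h: "edge_functional h" "e \<in> normed_vertices h"
    using edge_at[OF e(1)] by blast
  have fg: "normed_vertices f \<noteq> normed_vertices g"
    using c(2) g(2) by blast
  have "normed_vertices h \<noteq> normed_vertices f" "normed_vertices h \<noteq> normed_vertices g"
    using e(2) h(2) unfolding y z by blast+
  then have "x \<notin> normed_vertices h"
    using edge_functionals_at_vertex[OF f g(1) h(1) x] fg by blast
  then have yh: "y \<in> normed_vertices h" and zh: "z \<in> normed_vertices h"
    using meet[OF f h(1)] meet[OF g(1) h(1)] neg[OF h(1)] unfolding y z by blast+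
  obtain p where p: "normed_vertices h = {y, - y, p, - p}"
    using normed_vertices_edge[OF h(1) yh] by blast
  \<comment> \<open>Otherwise \<open>f\<close> and \<open>g\<close> would have the same normed
    vertices.\<close>
  have "z \<noteq> y" "z \<noteq> - y"
    using fg unfolding y z by (fastforce simp: insert_commute)+
  then have "z = p \<or> z = - p"
    using zh unfolding p by blast
  then have "normed_vertices h \<subseteq> {y, - y, z, - z}"
    unfolding p by (elim disjE) (simp_all add: insert_commute)
  then show False
    using h(2) e(2) by blast
qed

lemma card_le_6_imp_edges_meet:
  assumes "card E \<le> 6" "edge_functional f" "edge_functional g"
  shows "normed_vertices f \<inter> normed_vertices g \<noteq> {}"
proof
  assume "normed_vertices f \<inter> normed_vertices g = {}"
  moreover have fin: "finite (normed_vertices f)" "finite (normed_vertices g)"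
    using finite_Ext by (auto simp: normed_vertices_def)
  ultimately have "card (normed_vertices f \<union> normed_vertices g) = 8"
    using card_Un_disjoint card_normed_vertices assms(2,3) by fastforce
  moreover have "card (normed_vertices f \<union> normed_vertices g) \<le> card E"
    using finite_Ext by (intro card_mono) (auto simp: normed_vertices_def)
  ultimately show False
    using assms(1) by linarith
qed

section \<open>Extreme contractions as pairs of edge functionals\<close>

text \<open>If all normed vertices of a component were parallel, some nonzero functional
  \<open>h\<close> would vanish on them. The other vertices leave slack, so this component could be
  moved by a small multiple of \<open>h\<close> in both directions with the other one fixed, and
  \<open>T\<close> would be a midpoint.\<close>

lemma component_edge_functional:
  assumes T: "extreme_contraction (T :: 'a \<Rightarrow>\<^sub>L linf2)"
  shows "edge_functional (\<lambda>x. vec_of_linf2 (T x) $ i)"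
proof -
  define f where "f x = vec_of_linf2 (T x) $ i" for x
  have normT: "norm T \<le> 1"
    using T by (auto simp: extreme_contraction_def Ext_def extreme_point_of_def)
  have Tx: "norm (T x) \<le> norm x" for x
    using norm_blinfun[of T x] normT mult_right_mono[OF normT norm_ge_zero[of x]] by simp
  have comp: "\<bar>vec_of_linf2 (T x) $ j\<bar> \<le> norm x" for x j
    using Tx[of x] norm_linf2_le_iff by blast
  have linf: "linear f"
    unfolding f_def by (intro linearI) (auto simp: blinfun.add_right blinfun.scaleR_right)
  have fle: "\<bar>f v\<bar> \<le> 1" if "v \<in> E" for v
    using comp[of v i] norm_Ext[OF that] by (simp add: f_def)
  have "\<exists>u\<in>E. \<exists>w\<in>E. D u w \<noteq> 0 \<and> \<bar>f u\<bar> = 1 \<and> \<bar>f w\<bar> = 1"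
  proof (rule ccontr)
    assume no: "\<not> ?thesis"
    \<comment> \<open>If there is a normed vertex \<open>u\<close>, all normed vertices are parallel
      to it and \<open>D u\<close> vanishes there; if there is none, any nonzero \<open>D u\<close>
      serves.\<close>
    obtain h where h: "linear h" "\<And>w. w \<in> E \<Longrightarrow> \<bar>f w\<bar> = 1 \<Longrightarrow> h w = 0" and "\<exists>z. h z \<noteq> (0::real)"
    proof (cases "\<exists>u\<in>E. \<bar>f u\<bar> = 1")
      case True
      then obtain u where u: "u \<in> E" "\<bar>f u\<bar> = 1"
        by blast
      moreover obtain z where "D u z \<noteq> 0"
        using ex_D_neq_0[OF Ext_nonzero[OF u(1)]] .
      ultimately show thesis
        using no by (intro that[OF linear_D[of u]]) blast+
    next
      case False
      moreover obtain u z where "D u z \<noteq> 0"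
        using nondegenerate by blast
      ultimately show thesis
        by (intro that[OF linear_D[of u]]) blast+
    qed
    then obtain z where z: "h z \<noteq> 0"
      by blast
    \<comment> \<open>The inserted 1 covers the case of no vertex with slack; the summand 1 keeps
      the denominators positive where \<open>h\<close> vanishes.\<close>
    define \<epsilon> where "\<epsilon> = Min (insert 1 ((\<lambda>v. (1 - \<bar>f v\<bar>) / (1 + \<bar>h v\<bar>)) ` {v \<in> E. \<bar>f v\<bar> < 1}))"
    have "\<epsilon> > 0"
      unfolding \<epsilon>_def using finite_Ext by (subst Min_gr_iff) (auto intro!: divide_pos_pos)
    have small: "\<epsilon> * \<bar>h v\<bar> \<le> 1 - \<bar>f v\<bar>" if v: "v \<in> E" for v
    proof (cases "\<bar>f v\<bar> = 1")
      case False
      then have "\<bar>f v\<bar> < 1"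
        using fle[OF v] by simp
      then have "\<epsilon> \<le> (1 - \<bar>f v\<bar>) / (1 + \<bar>h v\<bar>)"
        unfolding \<epsilon>_def using v finite_Ext by (intro Min_le) auto
      then have "\<epsilon> * (1 + \<bar>h v\<bar>) \<le> 1 - \<bar>f v\<bar>"
        by (simp add: pos_le_divide_eq add_pos_nonneg)
      then show ?thesis
        using \<open>\<epsilon> > 0\<close> by (simp add: algebra_simps)
    qed (use h(2)[OF v] in simp)
    define g where "g s x = f x + s * \<epsilon> * h x" for s x
    have g_le: "\<bar>g s x\<bar> \<le> norm x" if "\<bar>s\<bar> = 1" for s x
    proof (rule functional_bound)
      show "linear (g s)"
        unfolding g_def using linf h(1)
        by (intro linearI) (auto simp: linear_add linear_scale algebra_simps)
      show "\<bar>g s v\<bar> \<le> 1" if "v \<in> E" for v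
      proof -
        have "\<bar>g s v\<bar> \<le> \<bar>f v\<bar> + \<epsilon> * \<bar>h v\<bar>"
          unfolding g_def using abs_triangle_ineq[of "f v" "s * \<epsilon> * h v"] \<open>\<bar>s\<bar> = 1\<close> \<open>\<epsilon> > 0\<close>
          by (simp add: abs_mult)
        then show ?thesis
          using small[OF that] by simp
      qed
    qed
    define F where "F j x = (if j = i then \<epsilon> * h x else 0)" for j :: 2 and x
    have linF: "linear (F j)" for j
      unfolding F_def using h(1) by (intro linearI) (auto simp: linear_add linear_scale algebra_simps)
    \<comment> \<open>The function \<open>2 * \<epsilon> * h\<close> is the difference of
      \<open>g 1\<close> and \<open>g (- 1)\<close>, both bounded by the norm.\<close>
    have boundF: "\<bar>F j x\<bar> \<le> 2 * norm x" for j x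
      using g_le[of 1 x] g_le[of "- 1" x] by (auto simp: F_def g_def)
    obtain d :: "'a \<Rightarrow>\<^sub>L linf2" where d: "\<And>x j. vec_of_linf2 (d x) $ j = F j x"
      by (rule blinfun_linf2_exists[of F, OF linF boundF]) (rule that)
    have "norm (T + s *\<^sub>R d) \<le> 1" if "\<bar>s\<bar> = 1" for s
    proof (rule norm_blinfun_bound)
      show "norm ((T + s *\<^sub>R d) x) \<le> 1 * norm x" for x
        using g_le[OF that, of x] comp[of x]
        by (auto simp: norm_linf2_le_iff blinfun.bilinear_simps d F_def g_def f_def mult.assoc)
    qed simp
    from this[of 1] this[of "- 1"] have "T + d \<in> cball 0 1" "T - d \<in> cball 0 1"
      by simp_all
    moreover have "d \<noteq> 0"
      using d[of z i] z \<open>\<epsilon> > 0\<close> by (auto simp: F_def)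
    ultimately show False
      using T not_extreme_point_of_midpoint unfolding extreme_contraction_def Ext_def by blast
  qed
  then show ?thesis
    using linf fle unfolding edge_functional_def f_def by blast
qed

text \<open>If \<open>T\<close> lay strictly between \<open>A\<close> and \<open>B\<close>, each
  component of \<open>T\<close> would be the same convex combination of theirs, so these agree by
  \<open>edge_functional_not_between\<close>. The norm is 1 because an edge functional has modulus 1
  at some vertex.\<close>

lemma extreme_contraction_of_edge_functionals:
  assumes F: "\<And>i. edge_functional (F i)"
  obtains T :: "'a \<Rightarrow>\<^sub>L linf2" where "extreme_contraction T" "norm T = 1"
    "\<And>x i. vec_of_linf2 (T x) $ i = F i x"
proof -
  have "\<bar>F i x\<bar> \<le> 1 * norm x" for i x
    using edge_functional_bound[OF F] by simp
  then obtain T :: "'a \<Rightarrow>\<^sub>L linf2" where T: "\<And>x j. vec_of_linf2 (T x) $ j = F j x"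
    by (rule blinfun_linf2_exists[of F, OF edge_functional_linear[OF F]]) (rule that)
  have le: "norm T \<le> 1"
    using edge_functional_bound[OF F]
    by (intro norm_blinfun_bound) (auto simp: norm_linf2_le_iff T)
  have "norm T \<ge> 1"
  proof -
    obtain u where u: "u \<in> E" "\<bar>F 1 u\<bar> = 1"
      using F[of 1] unfolding edge_functional_def by blast
    have "\<bar>F 1 u\<bar> \<le> norm (T u)"
      using norm_linf2_le_iff[of "T u" "norm (T u)"] by (auto simp: T)
    also have "\<dots> \<le> norm T * norm u"
      by (rule norm_blinfun)
    finally show ?thesis
      using u norm_Ext by simp
  qed
  moreover have "T \<notin> open_segment A B" if AB: "A \<in> cball 0 1" "B \<in> cball 0 1" for A B
  proof
    assume "T \<in> open_segment A B"
    then obtain t where t: "0 < t" "t < 1" "A \<noteq> B" "T = (1 - t) *\<^sub>R A + t *\<^sub>R B"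
      by (auto simp: in_segment)
    have bound: "\<bar>vec_of_linf2 (C v) $ i\<bar> \<le> 1" if "C \<in> cball 0 1" "v \<in> E" for C :: "'a \<Rightarrow>\<^sub>L linf2" and v i
    proof -
      have "norm (C v) \<le> 1"
        using norm_blinfun[of C v] that norm_Ext[of v] by simp
      then show ?thesis
        using norm_linf2_le_iff by blast
    qed
    have lin: "linear (\<lambda>x. vec_of_linf2 (C x) $ i)" for C :: "'a \<Rightarrow>\<^sub>L linf2" and i
      by (intro linearI) (auto simp: blinfun.add_right blinfun.scaleR_right)
    have "vec_of_linf2 (A x) $ i = vec_of_linf2 (B x) $ i" for x i
    proof (rule edge_functional_not_between[OF F lin bound[OF AB(1)] lin bound[OF AB(2)] t(1,2)])
      show "F i x = (1 - t) * vec_of_linf2 (A x) $ i + t * vec_of_linf2 (B x) $ i" for x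
        unfolding T[symmetric] t(4) by (simp add: blinfun.bilinear_simps)
    qed
    then have "A = B"
      by (intro blinfun_eqI) (simp add: linf2_eq_iff vec_eq_iff)
    then show False
      using t(3) by simp
  qed
  ultimately show thesis
    using le T by (intro that) (auto simp: extreme_contraction_def Ext_def extreme_point_of_def)
qed

text \<open>By \<open>Ext_cball_linf2\<close>, a vertex is sent to a vertex exactly when it is a
  common normed vertex of both components, and the two preceding lemmas match extreme contractions
  with pairs of edge functionals.\<close>

lemma weak_LP_iff_edges_meet:
  "weak_LP TYPE('a) TYPE(linf2) \<longleftrightarrow>
    (\<forall>f g. edge_functional f \<longrightarrow> edge_functional g \<longrightarrow> normed_vertices f \<inter> normed_vertices g \<noteq> {})"
proof (intro iffI allI impI)
  fix f g
  assume weak: "weak_LP TYPE('a) TYPE(linf2)" and fg: "edge_functional f" "edge_functional g"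
  define F where "F i = (if i = 1 then f else g)" for i :: 2
  have "edge_functional (F i)" for i
    using fg by (simp add: F_def)
  then obtain T :: "'a \<Rightarrow>\<^sub>L linf2" where T: "extreme_contraction T" "norm T = 1"
    "\<And>x i. vec_of_linf2 (T x) $ i = F i x"
    by (rule extreme_contraction_of_edge_functionals) (rule that)
  obtain x where x: "x \<in> E" "T x \<in> Ext (cball 0 1)"
    using weak T(1,2) unfolding weak_LP_def by blast
  then have "\<bar>F i x\<bar> = 1" for i
    unfolding Ext_cball_linf2 T(3)[symmetric] by blast
  from this[of 1] this[of 2] show "normed_vertices f \<inter> normed_vertices g \<noteq> {}"
    using x(1) by (auto simp: F_def normed_vertices_def)
next
  assume meet: "\<forall>f g. edge_functional f \<longrightarrow> edge_functional g \<longrightarrow>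
    normed_vertices f \<inter> normed_vertices g \<noteq> {}"
  show "weak_LP TYPE('a) TYPE(linf2)"
    unfolding weak_LP_def
  proof (intro allI impI)
    fix T :: "'a \<Rightarrow>\<^sub>L linf2"
    assume "extreme_contraction T \<and> norm T = 1"
    then have "edge_functional (\<lambda>x. vec_of_linf2 (T x) $ i)" for i
      using component_edge_functional by blast
    then obtain x where "x \<in> E" "\<bar>vec_of_linf2 (T x) $ 1\<bar> = 1" "\<bar>vec_of_linf2 (T x) $ 2\<bar> = 1"
      using meet unfolding normed_vertices_def by blast
    then show "blinfun_apply T ` E \<inter> Ext (cball 0 1) \<noteq> {}"
      by (auto simp: Ext_cball_linf2 forall_2)
  qed
qed

end

section \<open>The coordinate determinant and the characterization\<close>

lemma polygonal_plane_exists: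
  assumes dim: "dim (UNIV :: 'a::banach set) = 2" and "polygonal TYPE('a)"
  obtains D :: "'a::banach \<Rightarrow> 'a \<Rightarrow> real" where "polygonal_plane D"
proof -
  obtain b1 b2 :: 'a and p1 p2 where p: "linear p1" "linear p2" "\<And>x. x = p1 x *\<^sub>R b1 + p2 x *\<^sub>R b2"
    "p1 b1 = 1" "p2 b1 = 0" "p1 b2 = 0" "p2 b2 = 1"
    by (rule dim_2_coordinates[OF dim]) (rule that)
  define D where "D u v = p1 u * p2 v - p2 u * p1 v" for u v
  have ext: "x = y" if "p1 x = p1 y" "p2 x = p2 y" for x y
    using that p(3) by metis
  show thesis
  proof (rule that[of D], unfold_locales)
    show "D u (x + y) = D u x + D u y" "D u (r *\<^sub>R x) = r *\<^sub>R D u x" for u x y r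
      using p(1,2) by (auto simp: D_def linear_add linear_scale algebra_simps)
    show "D u v = - D v u" for u v
      by (simp add: D_def)
    show "D u v *\<^sub>R x = D x v *\<^sub>R u + D u x *\<^sub>R v" for u v x
      using p(1,2) by (intro ext; simp add: D_def linear_add linear_scale; simp add: algebra_simps)
    show "\<exists>u v. D u v \<noteq> 0"
      using p by (intro exI[of _ b1] exI[of _ b2]) (simp add: D_def)
  qed (use assms cball_eq_hull_Ext[OF dim] in \<open>auto simp: polygonal_def\<close>)
qed

theorem theorem2p8:
  assumes "dim (UNIV :: 'a::banach set) = 2"
    and "polygonal TYPE('a)"
  shows "weak_LP TYPE('a) TYPE(linf2) \<longleftrightarrow> card (Ext (cball (0::'a) 1)) \<le> 6"
proof -
  obtain D :: "'a \<Rightarrow> 'a \<Rightarrow> real" where "polygonal_plane D"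
    using polygonal_plane_exists[OF assms] .
  then interpret polygonal_plane D .
  show ?thesis
    unfolding weak_LP_iff_edges_meet
    using edges_meet_imp_card_le_6 card_le_6_imp_edges_meet by blast
qed

end
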